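(* Let $G$ be any graph on $n$ vertices, let $p\in(0,1]$, and let $\pi$ be any permutation of $V(G)$. Then $\gamma_p(G)\le\gamma_p(\pi G)\le 2\gamma_p(G)$.
   Context: All graphs are finite, simple and undirected. For a graph $H$ and $S\subseteq V(H)$, $N[S]=N_H[S]$ denotes the closed neighborhood of $S$, i.e. $S$ together with all vertices adjacent to some vertex of $S$. For $p\in(0,1]$, a set $S\subseteq V(H)$ is a $p$-dominating set of $H$ if $|N[S]|/|V(H)|\ge p$; the $p$-domination number $\gamma_p(H)$ is the minimum cardinality of a $p$-dominating set of $H$. For a permutation $\pi$ of $V(G)$, the prism $\pi G$ is the graph on $2|V(G)|$ vertices obtained from two disjoint copies $G_1$ and $G_2$ of $G$ by joining, for each $v\in V(G)$, the copy of $v$ in $G_1$ to the copy of $\pi(v)$ in $G_2$ by an edge. *)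

theory Defs
  imports
    Complex_Main
    "HOL-Combinatorics.Permutations"
    "Graph_Theory.Pair_Digraph"
begin

text \<open>
  A finite simple undirected graph is a \<^locale>\<open>pair_graph\<close>: a finite vertex set together with an
  irreflexive and symmetric set of arcs, each edge being represented by its two orientations.
\<close>

definition closed_nbhd :: "'a pair_pre_digraph \<Rightarrow> 'a set \<Rightarrow> 'a set" where
  "closed_nbhd H S = S \<union> {v. \<exists>u\<in>S. (u, v) \<in> parcs H}"

definition p_dominating :: "real \<Rightarrow> 'a pair_pre_digraph \<Rightarrow> 'a set \<Rightarrow> bool" where
  "p_dominating p H S \<longleftrightarrow>
     S \<subseteq> pverts H \<and> real (card (closed_nbhd H S)) / real (card (pverts H)) \<ge> p"

text \<open>
  For a nonempty \<^locale>\<open>pair_graph\<close> and \<open>p \<le> 1\<close> the infimum is attained, since the whole vertex set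
  is p-dominating (\<open>p_domination_number_attained\<close> below). The ratio in the definition of
  p-domination is meaningless for the graph without vertices; for it the value here is
  \<open>Inf {} = 0\<close> when \<open>p > 0\<close>.
\<close>

definition p_domination_number :: "real \<Rightarrow> 'a pair_pre_digraph \<Rightarrow> nat" where
  "p_domination_number p H = Inf (card ` {S. p_dominating p H S})"

text \<open>The two disjoint copies of \<open>G\<close> are its images under \<^const>\<open>Inl\<close> and \<^const>\<open>Inr\<close>.\<close>

definition prism :: "('a \<Rightarrow> 'a) \<Rightarrow> 'a pair_pre_digraph \<Rightarrow> ('a + 'a) pair_pre_digraph" where
  "prism \<pi> G = \<lparr>
     pverts = pverts G <+> pverts G,
     parcs = {(Inl u, Inl v) | u v. (u, v) \<in> parcs G} \<union>
             {(Inr u, Inr v) | u v. (u, v) \<in> parcs G} \<union>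
             {(Inl v, Inr (\<pi> v)) | v. v \<in> pverts G} \<union>
             {(Inr (\<pi> v), Inl v) | v. v \<in> pverts G} \<rparr>"

lemma pair_graph_prism:
  assumes "pair_graph G" and "\<pi> permutes pverts G"
  shows "pair_graph (prism \<pi> G)"
proof -
  interpret pair_graph G by fact
  have \<pi>: "\<pi> v \<in> pverts G" if "v \<in> pverts G" for v
    using that assms(2) by (simp add: permutes_in_image)
  have sym: "(v, u) \<in> parcs G" if "(u, v) \<in> parcs G" for u v
    using that pair_sym_arcs by (auto simp: symmetric_def dest: symD)
  have fin: "finite (pverts (prism \<pi> G))"
    by (simp add: prism_def pair_finite_verts)
  have sub: "parcs (prism \<pi> G) \<subseteq> pverts (prism \<pi> G) \<times> pverts (prism \<pi> G)"
    by (auto simp: prism_def \<pi> dest: in_arcsD1 in_arcsD2)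
  show ?thesis
  proof
    show "finite (parcs (prism \<pi> G))"
      using sub fin by (meson finite_SigmaI finite_subset)
    show "symmetric (with_proj (prism \<pi> G))"
      by (auto simp: symmetric_def prism_def intro!: symI dest: sym)
    show "finite (pverts (prism \<pi> G))"
      by (fact fin)
    show "fst e \<in> pverts (prism \<pi> G)" "snd e \<in> pverts (prism \<pi> G)"
      if "e \<in> parcs (prism \<pi> G)" for e
      using that sub by (auto simp: mem_Times_iff)
    show "fst e \<noteq> snd e" if "e \<in> parcs (prism \<pi> G)" for e
      using that by (auto simp: prism_def dest: pair_no_loops)
  qed
qed

lemma card_pverts_prism:
  assumes "pair_graph G"
  shows "card (pverts (prism \<pi> G)) = 2 * card (pverts G)"
proof -
  interpret pair_graph G by fact
  show ?thesis
    by (simp add: prism_def card_Plus pair_finite_verts)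
qed

lemma p_domination_number_attained:
  assumes "pair_graph H" and "pverts H \<noteq> {}" and "p \<le> 1"
  shows "\<exists>S. p_dominating p H S \<and> card S = p_domination_number p H"
    and "p_dominating p H S \<Longrightarrow> p_domination_number p H \<le> card S"
proof -
  interpret pair_graph H by fact
  have "closed_nbhd H (pverts H) = pverts H"
    by (auto simp: closed_nbhd_def dest: in_arcsD2)
  then have "p_dominating p H (pverts H)"
    using assms(2,3) pair_finite_verts by (simp add: p_dominating_def)
  then have "p_domination_number p H \<in> card ` {S. p_dominating p H S}"
    unfolding p_domination_number_def by (intro Inf_nat_def1) auto
  then show "\<exists>S. p_dominating p H S \<and> card S = p_domination_number p H"
    by auto
  show "p_dominating p H S \<Longrightarrow> p_domination_number p H \<le> card S"
    unfolding p_domination_number_def by (intro cInf_lower) auto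
qed

end

theory Submission
  imports Defs
begin

text \<open>
  A set of vertices of the prism is \<open>A <+> B\<close>, with \<open>A\<close> in the first copy of \<open>G\<close> and \<open>B\<close> in the
  second. Besides what \<open>A\<close> and \<open>B\<close> dominate within their own copies, it dominates only the
  matching partners \<open>\<pi>\<^sup>-\<^sup>1(B)\<close> in the first copy and \<open>\<pi>(A)\<close> in the second
  (\<open>closed_nbhd_prism\<close>).

  For the upper bound, a p-dominating set \<open>S\<close> of \<open>G\<close> taken in both copies dominates the proportion
  \<open>p\<close> of each copy, hence of the prism.

  For the lower bound, let \<open>A <+> B\<close> be p-dominating in the prism. By averaging it dominates at
  least the proportion \<open>p\<close> of one of the copies. Moving the vertices of the other copy along the
  matching into that copy loses nothing there, since each of them dominated only its partner
  in it. Thus \<open>A \<union> \<pi>\<^sup>-\<^sup>1(B)\<close> or \<open>\<pi>(A) \<union> B\<close> is p-dominating in \<open>G\<close>, and both have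
  at most \<open>card A + card B\<close> elements.
\<close>

lemma finite_closed_nbhd:
  assumes "pair_graph G" and "S \<subseteq> pverts G"
  shows "finite (closed_nbhd G S)"
proof -
  interpret pair_graph G by fact
  have "closed_nbhd G S \<subseteq> pverts G"
    using assms(2) by (auto simp: closed_nbhd_def dest: in_arcsD2)
  then show ?thesis
    using pair_finite_verts by (rule finite_subset)
qed

lemma closed_nbhd_prism:
  fixes G :: "'a pair_pre_digraph"
  assumes "\<pi> permutes pverts G" and "A \<subseteq> pverts G" and "B \<subseteq> pverts G"
  shows "closed_nbhd (prism \<pi> G) (A <+> B) =
    (closed_nbhd G A \<union> inv \<pi> ` B) <+> (closed_nbhd G B \<union> \<pi> ` A)"
proof -
  have preimage: "v \<in> inv \<pi> ` B \<longleftrightarrow> v \<in> pverts G \<and> \<pi> v \<in> B" for v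
    using assms(3) permutes_inverses[OF assms(1)] permutes_in_image[OF assms(1)]
    by (metis image_iff subsetD)
  have bex: "(\<exists>u\<in>A <+> B. P u) \<longleftrightarrow> (\<exists>a\<in>A. P (Inl a)) \<or> (\<exists>b\<in>B. P (Inr b))" for P
    by (auto simp: Plus_def)
  have mem: "Inl v \<in> X <+> Y \<longleftrightarrow> v \<in> X" "Inr v \<in> X <+> Y \<longleftrightarrow> v \<in> Y"
    for v and X Y :: "'a set"
    by (auto simp: Plus_def)
  have "x \<in> closed_nbhd (prism \<pi> G) (A <+> B) \<longleftrightarrow>
      x \<in> (closed_nbhd G A \<union> inv \<pi> ` B) <+> (closed_nbhd G B \<union> \<pi> ` A)" for x
  proof (cases x)
    case (Inl v)
    show ?thesis
      unfolding Inl by (simp add: closed_nbhd_def prism_def bex mem preimage) blast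
  next
    case (Inr v)
    have "v \<in> \<pi> ` A \<longleftrightarrow> (\<exists>a\<in>A. a \<in> pverts G \<and> v = \<pi> a)"
      using assms(2) by blast
    then show ?thesis
      unfolding Inr by (simp add: closed_nbhd_def prism_def bex mem) blast
  qed
  then show ?thesis
    by (rule set_eqI)
qed

lemma p_dominating_iff:
  assumes "pair_graph H" and "pverts H \<noteq> {}"
  shows "p_dominating p H S \<longleftrightarrow>
    S \<subseteq> pverts H \<and> p * real (card (pverts H)) \<le> real (card (closed_nbhd H S))"
proof -
  interpret pair_graph H by fact
  have "0 < card (pverts H)"
    using assms(2) pair_finite_verts by (simp add: card_gt_0_iff)
  then show ?thesis
    by (simp add: p_dominating_def pos_le_divide_eq)
qed

lemma p_dominating_prism_double:
  assumes "pair_graph G" and "pverts G \<noteq> {}" and "\<pi> permutes pverts G"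
    and "p_dominating p G S"
  shows "p_dominating p (prism \<pi> G) (S <+> S)"
proof -
  interpret pair_graph G by fact
  have S: "S \<subseteq> pverts G" "p * real (card (pverts G)) \<le> real (card (closed_nbhd G S))"
    using assms(4) by (simp_all add: p_dominating_iff assms(1,2))
  have ne: "pverts (prism \<pi> G) \<noteq> {}" and sub: "S <+> S \<subseteq> pverts (prism \<pi> G)"
    using assms(2) S(1) by (auto simp: prism_def)
  have fin: "finite (closed_nbhd G S)" "finite S"
    using S(1) assms(1) pair_finite_verts by (auto intro: finite_closed_nbhd finite_subset)
  have "closed_nbhd G S <+> closed_nbhd G S \<subseteq> closed_nbhd (prism \<pi> G) (S <+> S)"
    unfolding closed_nbhd_prism[OF assms(3) S(1) S(1)] by auto
  then have "card (closed_nbhd G S <+> closed_nbhd G S)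
      \<le> card (closed_nbhd (prism \<pi> G) (S <+> S))"
    using fin by (intro card_mono) (simp_all add: closed_nbhd_prism[OF assms(3) S(1) S(1)])
  then have "2 * card (closed_nbhd G S) \<le> card (closed_nbhd (prism \<pi> G) (S <+> S))"
    using fin by (simp add: card_Plus)
  then show ?thesis
    using S(2) sub
    by (simp add: p_dominating_iff[OF pair_graph_prism[OF assms(1,3)] ne]
        card_pverts_prism[OF assms(1)])
qed

text \<open>
  The condition on \<open>X\<close> is met by the part that a set of prism vertices dominates within one copy:
  \<open>A\<close> is its part in that copy, and \<open>C\<close> consists of the partners of its part in the other copy.
\<close>

lemma p_dominating_Un_partners:
  assumes "pair_graph G" and "pverts G \<noteq> {}" and "A \<subseteq> pverts G" and "C \<subseteq> pverts G"
    and "X = closed_nbhd G A \<union> C" and "p * real (card (pverts G)) \<le> real (card X)"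
  shows "p_dominating p G (A \<union> C)"
proof -
  have "X \<subseteq> closed_nbhd G (A \<union> C)"
    unfolding assms(5) by (auto simp: closed_nbhd_def)
  then have "card X \<le> card (closed_nbhd G (A \<union> C))"
    using finite_closed_nbhd[OF assms(1)] assms(3,4) by (intro card_mono) auto
  then show ?thesis
    using assms(3,4,6) by (simp add: p_dominating_iff assms(1,2))
qed

lemma p_dominating_of_prism:
  assumes "pair_graph G" and "pverts G \<noteq> {}" and "\<pi> permutes pverts G"
    and "p_dominating p (prism \<pi> G) T"
  shows "\<exists>S. p_dominating p G S \<and> card S \<le> card T"
proof -
  interpret pair_graph G by fact
  define A where "A = Inl -` T"
  define B where "B = Inr -` T"
  have T: "T = A <+> B"
  proof (rule set_eqI)
    show "x \<in> T \<longleftrightarrow> x \<in> A <+> B" for x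
      by (cases x) (auto simp: A_def B_def)
  qed
  have AB: "A \<subseteq> pverts G" "B \<subseteq> pverts G"
    using assms(4) unfolding T by (auto simp: p_dominating_def prism_def)
  then have fin: "finite A" "finite B"
    using pair_finite_verts by (auto intro: finite_subset)
  have cardT: "card T = card A + card B"
    unfolding T using fin by (rule card_Plus)
  define X where "X = closed_nbhd G A \<union> inv \<pi> ` B"
  define Y where "Y = closed_nbhd G B \<union> \<pi> ` A"
  have finXY: "finite X" "finite Y"
    unfolding X_def Y_def using fin AB finite_closed_nbhd[OF assms(1)] by simp_all
  have ne: "pverts (prism \<pi> G) \<noteq> {}"
    using assms(2) by (auto simp: prism_def)
  have "closed_nbhd (prism \<pi> G) T = X <+> Y"
    unfolding T X_def Y_def by (rule closed_nbhd_prism[OF assms(3) AB])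
  then have "p * real (2 * card (pverts G)) \<le> real (card X + card Y)"
    using assms(4) card_Plus[OF finXY]
    by (simp add: p_dominating_iff[OF pair_graph_prism[OF assms(1,3)] ne]
        card_pverts_prism[OF assms(1)])
  then consider "p * real (card (pverts G)) \<le> real (card X)"
    | "p * real (card (pverts G)) \<le> real (card Y)"
    by (cases "p * real (card (pverts G)) \<le> real (card X)") (auto simp: algebra_simps)
  then show ?thesis
  proof cases
    case 1
    have "inv \<pi> ` B \<subseteq> pverts G"
      using AB(2) permutes_in_image[OF permutes_inv[OF assms(3)]] by auto
    then have "p_dominating p G (A \<union> inv \<pi> ` B)"
      using p_dominating_Un_partners[OF assms(1,2) AB(1) _ X_def 1] by simp
    moreover have "card (A \<union> inv \<pi> ` B) \<le> card T"
      unfolding cardT using card_Un_le[of A "inv \<pi> ` B"] card_image_le[OF fin(2), of "inv \<pi>"]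
      by linarith
    ultimately show ?thesis by blast
  next
    case 2
    have "\<pi> ` A \<subseteq> pverts G"
      using AB(1) permutes_in_image[OF assms(3)] by auto
    then have "p_dominating p G (B \<union> \<pi> ` A)"
      using p_dominating_Un_partners[OF assms(1,2) AB(2) _ Y_def 2] by simp
    moreover have "card (B \<union> \<pi> ` A) \<le> card T"
      unfolding cardT using card_Un_le[of B "\<pi> ` A"] card_image_le[OF fin(1), of \<pi>]
      by linarith
    ultimately show ?thesis by blast
  qed
qed

theorem proposition3p5:
  fixes G :: "'a pair_pre_digraph" and p :: real and \<pi> :: "'a \<Rightarrow> 'a"
  assumes "pair_graph G"
    and "0 < p" and "p \<le> 1"
    and "\<pi> permutes pverts G"
  shows "p_domination_number p G \<le> p_domination_number p (prism \<pi> G) \<and>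
         p_domination_number p (prism \<pi> G) \<le> 2 * p_domination_number p G"
proof (cases "pverts G = {}")
  case True
  \<comment> \<open>Without vertices the ratio is \<open>0 / 0 = 0 < p\<close>, so no set dominates and both numbers are
    \<open>Inf {} = 0\<close>.\<close>
  then have "{S. p_dominating p G S} = {}" "{S. p_dominating p (prism \<pi> G) S} = {}"
    using assms(2) by (simp_all add: p_dominating_def prism_def Plus_def)
  then show ?thesis
    by (simp add: p_domination_number_def)
next
  case False
  interpret pair_graph G by fact
  let ?P = "prism \<pi> G"
  have P: "pair_graph ?P" "pverts ?P \<noteq> {}"
    using pair_graph_prism[OF assms(1,4)] False by (auto simp: prism_def)
  obtain S where S: "p_dominating p G S" "card S = p_domination_number p G"
    using p_domination_number_attained(1)[OF assms(1) False assms(3)] by blast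
  obtain T where T: "p_dominating p ?P T" "card T = p_domination_number p ?P"
    using p_domination_number_attained(1)[OF P assms(3)] by blast
  obtain S' where S': "p_dominating p G S'" "card S' \<le> card T"
    using p_dominating_of_prism[OF assms(1) False assms(4) T(1)] by blast
  have "p_domination_number p G \<le> card S'"
    by (rule p_domination_number_attained(2)[OF assms(1) False assms(3) S'(1)])
  moreover have "p_domination_number p ?P \<le> card (S <+> S)"
    by (rule p_domination_number_attained(2)[OF P assms(3)
          p_dominating_prism_double[OF assms(1) False assms(4) S(1)]])
  moreover have "finite S"
    using S(1) pair_finite_verts by (auto simp: p_dominating_def intro: finite_subset)
  ultimately show ?thesis
    using S(2) S'(2) T(2) by (simp add: card_Plus)
qed

end
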